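(* Let $\mu$ be the self-similar measure described in the context. Then for every $q<0$ there exists a Frostman measure at state $q$ for $\mu$; that is, for every $q<0$ there exist a Borel probability measure $\mu_q$ on $[0,1]$ and a constant $C>0$ such that $$\forall n,\ \forall I\in\mathcal{F}_n,\qquad \mu_q(I)\le C\,\mu(I)^q\,\ell^{-n\tau(q)},$$ where $\tau$ is the $L^q$-spectrum of $\mu$.
   Context: Let $\ell\ge 2$ be an integer. For $0\le i\le \ell-1$ define $S_i,S_{i+\ell}:[0,1]\to[0,1]$ by $S_i(x)=\frac{x}{\ell}+\frac{i}{\ell}$ and $S_{i+\ell}(x)=-\frac{x}{\ell}+\frac{i+1}{\ell}$. Let $(p_i)_{0\le i\le 2\ell-1}$ be a probability weight ($p_i\ge 0$, $\sum_i p_i=1$) with $p_i+p_{i+\ell}>0$ for every $0\le i\le \ell-1$ (equivalently, $\mu$ has support $[0,1]$). Let $\mu$ be the unique Borel probability measure on $[0,1]$ with $\mu=\sum_{i=0}^{2\ell-1}p_i\,\mu\circ S_i^{-1}$. For $n\ge 1$, $\mathcal{F}_n$ is the set of $\ell$-adic intervals $[k/\ell^n,(k+1)/\ell^n)$, $0\le k<\ell^n$, of generation $n$, with the convention that the last one ($k=\ell^n-1$) also contains the endpoint $1$. The $L^q$-spectrum of $\mu$ is $\tau(q)=\limsup_{n\to\infty}\tau_n(q)$ with $\tau_n(q)=\frac{1}{n\log\ell}\log\left(\sum_{I\in\mathcal{F}_n}\mu(I)^q\right)$, the sum running over the $I$ with $\mu(I)\ne 0$. *)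

theory Defs
  imports "HOL-Probability.Probability"
begin

definition simil :: "nat \<Rightarrow> nat \<Rightarrow> real \<Rightarrow> real" where
  "simil l i x =
     (if i < l then x / real l + real i / real l
      else - x / real l + (real (i - l) + 1) / real l)"

definition borel_prob_unit :: "real measure \<Rightarrow> bool" where
  "borel_prob_unit M \<longleftrightarrow> prob_space M \<and> sets M = sets (restrict_space borel {0..1})"

text \<open>Since \<open>space M\<close> is the unit interval, \<open>simil l i -` A \<inter> space M\<close> is the preimage of \<open>A\<close>
  under the \<open>i\<close>-th similarity regarded as a self-map of the unit interval.\<close>

definition self_similar :: "nat \<Rightarrow> (nat \<Rightarrow> real) \<Rightarrow> real measure \<Rightarrow> bool" where
  "self_similar l p M \<longleftrightarrow>
     (\<forall>A \<in> sets M. measure M A = (\<Sum>i<2 * l. p i * measure M (simil l i -` A \<inter> space M)))"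

definition ladic_interval :: "nat \<Rightarrow> nat \<Rightarrow> nat \<Rightarrow> real set" where
  "ladic_interval l n k =
     (if k = l ^ n - 1 then {real k / real (l ^ n)..1}
      else {real k / real (l ^ n)..<(real k + 1) / real (l ^ n)})"

definition ladic :: "nat \<Rightarrow> nat \<Rightarrow> real set set" where
  "ladic l n = ladic_interval l n ` {..<l ^ n}"

definition tau_n :: "nat \<Rightarrow> real measure \<Rightarrow> nat \<Rightarrow> real \<Rightarrow> real" where
  "tau_n l M n q =
     1 / (real n * ln (real l)) *
       ln (\<Sum>I | I \<in> ladic l n \<and> measure M I \<noteq> 0. measure M I powr q)"

definition Lq_spectrum :: "nat \<Rightarrow> real measure \<Rightarrow> real \<Rightarrow> ereal" where
  "Lq_spectrum l M q = limsup (\<lambda>n. ereal (tau_n l M n q))"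

text \<open>For a self-similar measure with \<open>p i + p (i + l) > 0\<close> for all \<open>i < l\<close>, the numbers
  \<open>measure M I\<close> are bounded below by a positive constant to the power \<open>n\<close>. Hence the spectrum
  is finite, so \<open>real_of_ereal\<close> loses nothing, and the convention \<open>0 powr q = 0\<close> is
  never met.\<close>

definition frostman_measure :: "nat \<Rightarrow> real measure \<Rightarrow> real \<Rightarrow> real measure \<Rightarrow> bool" where
  "frostman_measure l M q N \<longleftrightarrow>
     borel_prob_unit N \<and>
     (\<exists>C>0. \<forall>n\<ge>1. \<forall>I \<in> ladic l n.
        measure N I \<le>
          C * measure M I powr q * real l powr (- (real n * real_of_ereal (Lq_spectrum l M q))))"

end

theory Submission
  imports Defs
begin

text \<open>
  Write \<open>a(n,k)\<close> for the mass that \<open>\<mu>\<close> gives to the \<open>k\<close>-th interval of generation \<open>n\<close>, and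
  \<open>Z\<^sub>n = \<Sum>\<^sub>k a(n,k)\<^sup>q\<close>. The measure \<open>\<mu>\<close> has no atoms (\<open>atomless\<close>), so endpoints do not matter, and
  self-similarity gives \<open>a(n+m, k l\<^sup>m + j) = A a(m,j) + B a(m, l\<^sup>m - 1 - j)\<close> with \<open>A, B \<ge> 0\<close> depending
  only on \<open>n, k\<close> and \<open>A + B = a(n,k)\<close> (\<open>cell_decomp\<close>). As \<open>q < 0\<close>, it follows that
  \<open>\<Sum>\<^sub>j a(n+m, k l\<^sup>m + j)\<^sup>q \<le> 2 a(n,k)\<^sup>q Z\<^sub>m\<close> (\<open>sum_descendants_le\<close>). In particular \<open>2 Z\<^sub>n\<close> is
  submultiplicative, so \<open>2 Z\<^sub>n \<ge> l\<^bsup>n\<tau>(q)\<^esup>\<close> for every \<open>n\<close> (\<open>powr_T_le\<close>).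

  The Frostman measure is built as a Patterson--Sullivan limit. Let \<open>\<nu>\<^sub>N\<close> be the normalization of
  \<open>\<Sum>\<^sub>m\<^sub>\<le>\<^sub>N l\<^bsup>-m\<tau>(q)\<^esup> \<Sum>\<^sub>k a(m,k)\<^sup>q \<delta>\<^bsub>k/l^m\<^esub>\<close>. Its total mass before normalization is
  \<open>\<Sum>\<^sub>m\<^sub>\<le>\<^sub>N l\<^bsup>-m\<tau>(q)\<^esup> Z\<^sub>m \<ge> (N+1)/2\<close>, which tends to infinity, so the generations \<open>m < n\<close> contribute
  nothing in the limit, and the bound on descendants gives
  \<open>\<nu>\<^sub>N(I) \<le> o(1) + 2 a(n,k)\<^sup>q l\<^bsup>-n\<tau>(q)\<^esup>\<close> for the \<open>k\<close>-th interval \<open>I\<close> of generation \<open>n\<close>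
  (\<open>measure_approx_ladic_le\<close>).

  The bound passes to a weak limit of a subsequence unless the limit charges \<open>l\<close>-adic points. If the
  Frostman bound along the intervals containing \<open>0\<close> stays away from zero, the Dirac measure at \<open>0\<close> is a
  Frostman measure; similarly at \<open>1\<close>. Otherwise both bounds have infimum zero; by the decomposition
  above the bounds along the two sequences of intervals shrinking to any \<open>l\<close>-adic point have infimum
  zero as well, so the limit does not charge \<open>l\<close>-adic points and the \<open>l\<close>-adic intervals are continuity sets.
\<close>

section \<open>The self-similar measure has no atoms\<close>

text \<open>
  A self-similar measure for the \<open>l\<close>-adic contractions, indexed by \<open>i < l\<close>, and their reflected versions,
  indexed by \<open>i + l\<close>, in which every \<open>l\<close>-adic interval of the first generation is charged.
\<close>
locale flip_ladic =
  fixes l :: nat and p :: "nat \<Rightarrow> real" and \<mu> :: "real measure"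
  assumes l2: "l \<ge> 2"
    and p_nonneg: "\<And>i. i < 2 * l \<Longrightarrow> p i \<ge> 0"
    and p_sum: "(\<Sum>i<2 * l. p i) = 1"
    and p_pos: "\<And>i. i < l \<Longrightarrow> p i + p (i + l) > 0"
    and unit: "borel_prob_unit \<mu>"
    and self_sim: "self_similar l p \<mu>"
begin

sublocale prob_space \<mu>
  using unit by (simp add: borel_prob_unit_def)

lemma sets_mu: "sets \<mu> = sets (restrict_space borel {0..1})"
  using unit by (simp add: borel_prob_unit_def)

lemma space_mu: "space \<mu> = {0..1}"
  using sets_eq_imp_space_eq[OF sets_mu] by simp

lemma sets_muI: "A \<in> sets borel \<Longrightarrow> A \<subseteq> {0..1} \<Longrightarrow> A \<in> sets \<mu>"
  unfolding sets_mu by (simp add: sets_restrict_space_iff)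

lemma self_sim_eq:
  assumes "A \<in> sets \<mu>"
  shows "prob A = (\<Sum>i<l. p i * prob (simil l i -` A \<inter> {0..1})
      + p (i + l) * prob (simil l (i + l) -` A \<inter> {0..1}))"
proof -
  have eq: "{..<2 * l} = {..<l} \<union> (\<lambda>i. i + l) ` {..<l}"
  proof (intro equalityI subsetI)
    fix x assume x: "x \<in> {..<2 * l}"
    show "x \<in> {..<l} \<union> (\<lambda>i. i + l) ` {..<l}"
    proof (cases "x < l")
      case False
      then have "x = (x - l) + l" "x - l < l" using x by auto
      then show ?thesis by blast
    qed simp
  qed auto
  have "prob A = (\<Sum>i<2 * l. p i * prob (simil l i -` A \<inter> {0..1}))"
    using self_sim assms by (simp add: self_similar_def space_mu)
  also have "\<dots> = (\<Sum>i<l. p i * prob (simil l i -` A \<inter> {0..1}))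
     + (\<Sum>i\<in>(\<lambda>i. i + l) ` {..<l}. p i * prob (simil l i -` A \<inter> {0..1}))"
    unfolding eq by (rule sum.union_disjoint) auto
  also have "(\<Sum>i\<in>(\<lambda>i. i + l) ` {..<l}. p i * prob (simil l i -` A \<inter> {0..1}))
     = (\<Sum>i<l. p (i + l) * prob (simil l (i + l) -` A \<inter> {0..1}))"
    by (subst sum.reindex) (auto simp: inj_on_def)
  finally show ?thesis by (simp add: sum.distrib)
qed

lemma p_sum_pairs: "(\<Sum>i<l. p i + p (i + l)) = 1"
proof -
  have "prob {0..1} = (\<Sum>i<l. p i * prob (simil l i -` {0..1} \<inter> {0..1})
      + p (i + l) * prob (simil l (i + l) -` {0..1} \<inter> {0..1}))"
    by (rule self_sim_eq) (auto intro: sets_muI)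
  moreover have "simil l i -` {0..1} \<inter> {0..1} = {0..1}"
      "simil l (i + l) -` {0..1} \<inter> {0..1} = {0..1}" if "i < l" for i
  proof -
    have "real i + 1 \<le> real l" using that by linarith
    then show "simil l i -` {0..1} \<inter> {0..1} = {0..1}"
      "simil l (i + l) -` {0..1} \<inter> {0..1} = {0..1}"
      using that by (auto simp: simil_def divide_simps)
  qed
  ultimately show ?thesis using prob_space by (simp add: space_mu)
qed

lemma finite_large_atoms:
  assumes "e > 0" shows "finite {x. prob {x} \<ge> e}"
proof (rule finite_if_finite_subsets_card_bdd[where C = "nat \<lceil>1 / e\<rceil>", THEN conjunct1])
  fix F assume F: "F \<subseteq> {x. prob {x} \<ge> e}" "finite F"
  have "F \<subseteq> space \<mu>"
  proof
    fix x assume "x \<in> F"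
    then have "prob {x} > 0" using F assms by force
    then have "{x} \<in> sets \<mu>" using measure_notin_sets by force
    then show "x \<in> space \<mu>" using sets.sets_into_space by blast
  qed
  then have meas: "{x} \<in> sets \<mu>" if "x \<in> F" for x
    using that space_mu by (auto intro!: sets_muI)
  have "real (card F) * e \<le> (\<Sum>x\<in>F. prob {x})"
    using F sum_bounded_below[of F e "\<lambda>x. prob {x}"] by auto
  also have "\<dots> = prob F"
    using F(2) meas by (intro finite_measure_eq_sum_singleton[symmetric]) auto
  also have "\<dots> \<le> 1" by simp
  finally have "real (card F) \<le> 1 / e" using assms by (simp add: field_simps)
  then show "card F \<le> nat \<lceil>1 / e\<rceil>" by linarith
qed

text \<open>
  If an atom has the maximal mass, then it lies in the image of every map of positive weight, and its
  preimages under these maps again have the maximal mass. Since every first-generation interval is the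
  image of such a map, an atom of maximal mass must be the point \<open>1/2\<close>, with \<open>l = 2\<close>; but
  its preimages under the maps onto the left half of the unit interval are \<open>0\<close> or \<open>1\<close>.
\<close>
lemma atomless: "prob {x} = 0"
proof (rule ccontr)
  assume "prob {x} \<noteq> 0"
  then have e: "prob {x} > 0" using measure_nonneg[of \<mu> "{x}"] by linarith
  define F where "F = {y. prob {y} \<ge> prob {x}}"
  have F: "finite F" "x \<in> F" unfolding F_def using finite_large_atoms[OF e] by auto
  define M where "M = Max ((\<lambda>y. prob {y}) ` F)"
  have M_le: "prob {y} \<le> M" for y
  proof (cases "y \<in> F")
    case True then show ?thesis unfolding M_def using F by (intro Max_ge) auto
  next
    case False
    then have "prob {y} \<le> prob {x}" by (simp add: F_def)
    also have "\<dots> \<le> M" unfolding M_def using F by (intro Max_ge) auto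
    finally show ?thesis .
  qed
  have "M \<in> (\<lambda>y. prob {y}) ` F" unfolding M_def using F by (intro Max_in) auto
  then obtain y where y: "prob {y} = M" by auto
  have "M > 0" using M_le[of x] e by linarith
  have l0: "real l > 0" using l2 by simp
  have pre1: "simil l i -` {z} \<inter> {0..1} = {real l * z - real i} \<inter> {0..1}" if "i < l" for i and z :: real
    using that l0 by (auto simp: simil_def field_simps)
  have pre2: "simil l (i + l) -` {z} \<inter> {0..1} = {real i + 1 - real l * z} \<inter> {0..1}" for i and z :: real
    using l0 by (auto simp: simil_def field_simps)
  have half: "z \<ge> real i / real l \<and> z \<le> (real i + 1) / real l \<and>
      (prob {real l * z - real i} = M \<or> prob {real i + 1 - real l * z} = M)"
    if z: "prob {z} = M" and i: "i < l" for z :: real and i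
  proof -
    have zs: "z \<in> {0..1}"
      using z \<open>M > 0\<close> measure_notin_sets[of "{z}" \<mu>] sets.sets_into_space[of "{z}" \<mu>]
      unfolding space_mu by force
    let ?f = "\<lambda>i. p i * prob (simil l i -` {z} \<inter> {0..1})
      + p (i + l) * prob (simil l (i + l) -` {z} \<inter> {0..1})"
    have le: "prob ({u} \<inter> {0..1}) \<le> M" for u
      using M_le[of u] \<open>M > 0\<close> by (cases "u \<in> {0..1}") auto
    have fle: "?f j \<le> (p j + p (j + l)) * M" if "j < l" for j
      unfolding distrib_right pre1[OF that] pre2
      using that by (intro add_mono mult_left_mono le p_nonneg) auto
    have "{z} \<in> sets \<mu>" using zs by (intro sets_muI) auto
    then have "M = (\<Sum>j<l. ?f j)" using z self_sim_eq[of "{z}"] by simp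
    moreover have "(\<Sum>j<l. (p j + p (j + l)) * M) = M"
      using p_sum_pairs by (simp add: sum_distrib_right[symmetric])
    ultimately have "(\<Sum>j<l. (p j + p (j + l)) * M - ?f j) = 0"
      by (simp add: sum_subtractf)
    then have "(p i + p (i + l)) * M - ?f i = 0"
      using i fle by (subst (asm) sum_nonneg_eq_0_iff) auto
    then have eq: "p i * (M - prob ({real l * z - real i} \<inter> {0..1}))
        + p (i + l) * (M - prob ({real i + 1 - real l * z} \<inter> {0..1})) = 0"
      unfolding pre1[OF i] pre2 by (simp add: algebra_simps)
    have nn: "p i \<ge> 0" "p (i + l) \<ge> 0" using i by (auto intro: p_nonneg)
    have "p i * (M - prob ({real l * z - real i} \<inter> {0..1})) \<ge> 0"
      "p (i + l) * (M - prob ({real i + 1 - real l * z} \<inter> {0..1})) \<ge> 0"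
      using nn le by auto
    with eq have "p i * (M - prob ({real l * z - real i} \<inter> {0..1})) = 0"
      "p (i + l) * (M - prob ({real i + 1 - real l * z} \<inter> {0..1})) = 0" by linarith+
    with p_pos[OF i] have "prob ({real l * z - real i} \<inter> {0..1}) = M \<or>
      prob ({real i + 1 - real l * z} \<inter> {0..1}) = M" by auto
    moreover have "u \<in> {0..1} \<and> prob {u} = M" if "prob ({u} \<inter> {0..1}) = M" for u
      using that \<open>M > 0\<close> by (cases "u \<in> {0..1}") auto
    ultimately have "(real l * z - real i \<in> {0..1} \<and> prob {real l * z - real i} = M) \<or>
      (real i + 1 - real l * z \<in> {0..1} \<and> prob {real i + 1 - real l * z} = M)" by blast
    then show ?thesis using l0 by (auto simp: field_simps)
  qed
  have char: "l = 2 \<and> z = 1 / 2" if z: "prob {z} = M" for z :: real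
  proof -
    have 1: "z \<le> 1 / l" using half[OF z, of 0] l2 by simp
    have 2: "z \<ge> (real l - 1) / l" using half[OF z, of "l - 1"] l2 by (simp add: of_nat_diff)
    have "(real l - 1) / l \<le> 1 / l" using 1 2 by linarith
    then have "l = 2" using l2 by (simp add: field_simps)
    with 1 2 show ?thesis by simp
  qed
  have "prob {0} = M \<or> prob {1} = M"
    using half[OF y, of 0] char[OF y] by auto
  then show False using char by force
qed

section \<open>Masses of the \<open>l\<close>-adic intervals\<close>

text \<open>The mass of the \<open>k\<close>-th \<open>l\<close>-adic interval of generation \<open>n\<close>; meaningful for \<open>k < l ^ n\<close>.\<close>
definition cell :: "nat \<Rightarrow> nat \<Rightarrow> real" where
  "cell n k = prob (ladic_interval l n k)"

lemma lpow_pos: "real l ^ n > 0" using l2 by simp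

lemma ladic_interval_bounds:
  assumes "k < l ^ n"
  shows "{real k / real (l ^ n)<..<(real k + 1) / real (l ^ n)} \<subseteq> ladic_interval l n k"
    "ladic_interval l n k \<subseteq> {real k / real (l ^ n)..(real k + 1) / real (l ^ n)}"
    "{real k / real (l ^ n)..(real k + 1) / real (l ^ n)} \<subseteq> {0..1}"
proof -
  have "real k + 1 \<le> real (l ^ n)" using assms by (metis Suc_leI of_nat_Suc of_nat_le_iff add.commute)
  then have le: "(real k + 1) / real (l ^ n) \<le> 1" using l2 by simp
  have eq: "(real k + 1) / real (l ^ n) = 1" if "k = l ^ n - 1"
  proof -
    have "real k + 1 = real (l ^ n)" using that assms by (simp add: of_nat_diff)
    then show ?thesis using l2 by simp
  qed
  show "{real k / real (l ^ n)<..<(real k + 1) / real (l ^ n)} \<subseteq> ladic_interval l n k"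
    "ladic_interval l n k \<subseteq> {real k / real (l ^ n)..(real k + 1) / real (l ^ n)}"
    using eq le by (auto simp: ladic_interval_def)
  show "{real k / real (l ^ n)..(real k + 1) / real (l ^ n)} \<subseteq> {0..1}"
    using le by (auto intro: order_trans[rotated])
qed

lemma cell_eq_open:
  assumes "k < l ^ n"
  shows "cell n k = prob {real k / real (l ^ n)<..<(real k + 1) / real (l ^ n)}"
proof -
  let ?x = "real k / real (l ^ n)" and ?y = "(real k + 1) / real (l ^ n)"
  have "?x \<le> ?y" using lpow_pos by (simp add: divide_right_mono)
  then have sub: "{?x..?y} \<subseteq> {0..1}" "0 \<le> ?x" "?x \<le> 1" "0 \<le> ?y" "?y \<le> 1"
    using ladic_interval_bounds(3)[OF assms] by auto
  have m: "ladic_interval l n k \<in> sets \<mu>"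
  proof (rule sets_muI)
    show "ladic_interval l n k \<in> sets borel" by (simp add: ladic_interval_def)
    show "ladic_interval l n k \<subseteq> {0..1}"
      using ladic_interval_bounds(2)[OF assms] sub(1) by (rule subset_trans)
  qed
  have "{?x<..<?y} \<subseteq> {0..1}"
    using sub(1) greaterThanLessThan_subseteq_atLeastAtMost_iff by blast
  then have m': "{?x<..<?y} \<in> sets \<mu>" "{?x} \<in> sets \<mu>" "{?y} \<in> sets \<mu>"
    using sub by (auto intro: sets_muI simp del: of_nat_power)
  note m = m m'
  show ?thesis
    unfolding cell_def
  proof (rule antisym)
    have "prob (ladic_interval l n k) \<le> prob ({?x<..<?y} \<union> ({?x} \<union> {?y}))"
    proof (rule finite_measure_mono)
      show "ladic_interval l n k \<subseteq> {?x<..<?y} \<union> ({?x} \<union> {?y})"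
        using ladic_interval_bounds(2)[OF assms] by force
    qed (intro sets.Un m)
    also have "\<dots> \<le> prob {?x<..<?y} + (prob {?x} + prob {?y})"
      by (intro order_trans[OF measure_Un_le] add_mono measure_Un_le sets.Un m order_refl)
    finally show "prob (ladic_interval l n k) \<le> prob {?x<..<?y}" by (simp add: atomless)
    show "prob {?x<..<?y} \<le> prob (ladic_interval l n k)"
      using ladic_interval_bounds(1)[OF assms] m by (intro finite_measure_mono)
  qed
qed

lemma cell_0: "cell 0 0 = 1"
  using prob_space by (simp add: cell_def ladic_interval_def space_mu)

lemma flip_less: "k < (l::nat) ^ n \<Longrightarrow> l ^ n - 1 - k < l ^ n"
  by simp

text \<open>
  The interval with leading digit \<open>d\<close> meets the images of the similarities \<open>d\<close> and \<open>d + l\<close> only, up to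
  endpoints. The second one reverses the order of the intervals, whence the index \<open>l ^ n - 1 - k\<close>.
  Open intervals make the other preimages exactly empty.
\<close>
lemma cell_Suc:
  assumes d: "d < l" and k: "k < l ^ n"
  shows "cell (Suc n) (d * l ^ n + k) = p d * cell n k + p (d + l) * cell n (l ^ n - 1 - k)"
proof -
  define L where "L = real (l ^ n)"
  have L: "L > 0" "real l > 0" using l2 by (auto simp: L_def)
  define c where "c = real k / L"
  define e where "e = (real k + 1) / L"
  have kL: "real k + 1 \<le> L" unfolding L_def using k by (metis Suc_leI of_nat_Suc of_nat_le_iff add.commute)
  have ce: "0 \<le> c" "c < e" "e \<le> 1" using L kL by (auto simp: c_def e_def field_simps)
  have lt: "d * l ^ n + k < l ^ Suc n"
  proof -
    have "d * l ^ n + k < (d + 1) * l ^ n" using k by simp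
    also have "\<dots> \<le> l * l ^ n" using d by (intro mult_right_mono) auto
    finally show ?thesis by simp
  qed
  let ?A = "{(real d + c) / real l<..<(real d + e) / real l}"
  have ends: "real (d * l ^ n + k) / real (l ^ Suc n) = (real d + c) / real l"
    "(real (d * l ^ n + k) + 1) / real (l ^ Suc n) = (real d + e) / real l"
    using L by (auto simp: c_def e_def L_def field_simps)
  have A: "?A \<in> sets \<mu>"
    using ladic_interval_bounds[OF lt] unfolding ends by (intro sets_muI) auto
  have pre1: "simil l i -` ?A \<inter> {0..1} = (if i = d then {c<..<e} else ({}::real set))" if "i < l" for i
  proof -
    have "simil l i -` ?A \<inter> {0..1} = {x\<in>{0..1}. real d + c < x + real i \<and> x + real i < real d + e}"
      using that L by (auto simp: simil_def divide_simps)
    also have "\<dots> = (if i = d then {c<..<e} else ({}::real set))"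
    proof (cases "i = d")
      case True then show ?thesis using ce by auto
    next
      case False
      then have "real i \<ge> real d + 1 \<or> real d \<ge> real i + 1" by linarith
      then show ?thesis using False ce by auto
    qed
    finally show ?thesis .
  qed
  have pre2: "simil l (i + l) -` ?A \<inter> {0..1} = (if i = d then {1 - e<..<1 - c} else ({}::real set))" for i
  proof -
    have "simil l (i + l) -` ?A \<inter> {0..1} = {x\<in>{0..1}. real d + c < 1 - x + real i \<and> 1 - x + real i < real d + e}"
      using L by (auto simp: simil_def divide_simps)
    also have "\<dots> = (if i = d then {1 - e<..<1 - c} else ({}::real set))"
    proof (cases "i = d")
      case True then show ?thesis using ce by auto
    next
      case False
      then have "real i \<ge> real d + 1 \<or> real d \<ge> real i + 1" by linarith
      then show ?thesis using False ce by auto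
    qed
    finally show ?thesis .
  qed
  have flip: "real (l ^ n - 1 - k) = L - 1 - real k" using k by (simp add: L_def of_nat_diff)
  have c2: "cell n (l ^ n - 1 - k) = prob {1 - e<..<1 - c}"
  proof -
    have "(L - 1 - real k) / L = 1 - e" "(L - 1 - real k + 1) / L = 1 - c"
      using L by (auto simp: c_def e_def field_simps)
    then show ?thesis
      unfolding cell_eq_open[OF flip_less[OF k]] flip L_def[symmetric] by simp
  qed
  have "cell (Suc n) (d * l ^ n + k) = prob ?A"
    unfolding cell_eq_open[OF lt] ends ..
  also have "\<dots> = (\<Sum>i<l. p i * prob (simil l i -` ?A \<inter> {0..1})
      + p (i + l) * prob (simil l (i + l) -` ?A \<inter> {0..1}))"
    by (rule self_sim_eq[OF A])
  also have "\<dots> = (\<Sum>i<l. if i = d then p d * prob {c<..<e} + p (d + l) * prob {1 - e<..<1 - c} else 0)"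
    unfolding pre2 by (intro sum.cong refl) (simp add: pre1)
  also have "\<dots> = p d * prob {c<..<e} + p (d + l) * prob {1 - e<..<1 - c}"
    using d by simp
  also have "prob {c<..<e} = cell n k"
    unfolding cell_eq_open[OF k] c_def e_def L_def ..
  finally show ?thesis unfolding c2 .
qed

lemma cell_le_1: "cell n k \<le> 1"
  by (simp add: cell_def)

lemma cell_nonneg: "cell n k \<ge> 0"
  by (simp add: cell_def)

lemma split_index:
  assumes "k < l ^ Suc n"
  obtains d k' where "d < l" "k' < l ^ n" "k = d * l ^ n + k'"
proof
  show "k div l ^ n < l" using assms by (simp add: less_mult_imp_div_less)
  show "k mod l ^ n < l ^ n" using l2 by simp
  show "k = k div l ^ n * l ^ n + k mod l ^ n" by (simp only: div_mult_mod_eq)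
qed

lemma cell_pos: "k < l ^ n \<Longrightarrow> cell n k > 0"
proof (induction n arbitrary: k)
  case 0 then show ?case by (simp add: cell_0)
next
  case (Suc n)
  obtain d k' where *: "d < l" "k' < l ^ n" "k = d * l ^ n + k'"
    using split_index[OF Suc.prems] .
  have "p d \<ge> 0" "p (d + l) \<ge> 0" using * by (auto intro: p_nonneg)
  moreover have "p d > 0 \<or> p (d + l) > 0" using p_pos[OF *(1)] by linarith
  moreover have "cell n k' > 0" "cell n (l ^ n - 1 - k') > 0" using * Suc.IH flip_less by auto
  ultimately show ?case unfolding *(3) cell_Suc[OF *(1,2)]
    by (auto intro: add_pos_nonneg add_nonneg_pos)
qed

lemma index_less: "k < l ^ n \<Longrightarrow> j < l ^ m \<Longrightarrow> k * l ^ m + j < l ^ (n + m)"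
proof -
  assume k: "k < l ^ n" and j: "j < l ^ m"
  have "k * l ^ m + j < (k + 1) * l ^ m" using j by simp
  also have "\<dots> \<le> l ^ n * l ^ m" using k by (intro mult_right_mono) auto
  finally show ?thesis by (simp add: power_add)
qed

lemma flip_index:
  assumes "k < l ^ n" "j < l ^ m"
  shows "l ^ (n + m) - 1 - (k * l ^ m + j) = (l ^ n - 1 - k) * l ^ m + (l ^ m - 1 - j)"
proof -
  have "int (l ^ (n + m) - 1 - (k * l ^ m + j)) = int l ^ (n + m) - 1 - (int k * int l ^ m + int j)"
    using index_less[OF assms] by (simp add: of_nat_diff)
  also have "\<dots> = (int l ^ n - 1 - int k) * int l ^ m + (int l ^ m - 1 - int j)"
    by (simp add: algebra_simps power_add)
  also have "\<dots> = int ((l ^ n - 1 - k) * l ^ m + (l ^ m - 1 - j))"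
    using assms by (simp add: of_nat_diff)
  finally show ?thesis by linarith
qed

text \<open>
  The coefficients \<open>A\<close> and \<open>B\<close> are the weights of the orientation preserving and reversing compositions
  of \<open>n\<close> similarities that map the unit interval onto the given one.
\<close>
lemma cell_decomp:
  assumes "k < l ^ n"
  obtains A B where "A \<ge> 0" "B \<ge> 0" "A + B = cell n k"
    "\<And>m j. j < l ^ m \<Longrightarrow>
      cell (n + m) (k * l ^ m + j) = A * cell m j + B * cell m (l ^ m - 1 - j)"
proof -
  have "\<exists>A B. A \<ge> 0 \<and> B \<ge> 0 \<and> (\<forall>m j. j < l ^ m \<longrightarrow>
      cell (n + m) (k * l ^ m + j) = A * cell m j + B * cell m (l ^ m - 1 - j))"
    using assms
  proof (induction n arbitrary: k)
    case 0
    show ?case by (rule exI[of _ 1], rule exI[of _ 0]) (use 0 in simp)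
  next
    case (Suc n)
    obtain d k' where *: "d < l" "k' < l ^ n" "k = d * l ^ n + k'"
      using split_index[OF Suc.prems] .
    obtain A B where AB: "A \<ge> 0" "B \<ge> 0" "\<And>m j. j < l ^ m \<Longrightarrow>
      cell (n + m) (k' * l ^ m + j) = A * cell m j + B * cell m (l ^ m - 1 - j)"
      using Suc.IH[OF *(2)] by blast
    obtain A' B' where AB': "A' \<ge> 0" "B' \<ge> 0" "\<And>m j. j < l ^ m \<Longrightarrow>
      cell (n + m) ((l ^ n - 1 - k') * l ^ m + j) = A' * cell m j + B' * cell m (l ^ m - 1 - j)"
      using Suc.IH[OF flip_less[OF *(2)]] by blast
    have pd: "p d \<ge> 0" "p (d + l) \<ge> 0" using * by (auto intro: p_nonneg)
    have "cell (Suc n + m) (k * l ^ m + j)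
       = (p d * A + p (d + l) * B') * cell m j + (p d * B + p (d + l) * A') * cell m (l ^ m - 1 - j)"
      if j: "j < l ^ m" for m j
    proof -
      have k: "k * l ^ m + j = d * l ^ (n + m) + (k' * l ^ m + j)"
        unfolding *(3) by (simp add: algebra_simps power_add)
      have jj: "l ^ m - 1 - (l ^ m - 1 - j) = j" using j by simp
      show ?thesis
        unfolding k add_Suc cell_Suc[OF *(1) index_less[OF *(2) j]] flip_index[OF *(2) j]
          AB(3)[OF j] AB'(3)[OF flip_less[OF j]] jj
        by (simp add: algebra_simps)
    qed
    then show ?case using AB(1,2) AB'(1,2) pd
      by (intro exI[of _ "p d * A + p (d + l) * B'"] exI[of _ "p d * B + p (d + l) * A'"]) auto
  qed
  then obtain A B where AB: "A \<ge> 0" "B \<ge> 0" "\<And>m j. j < l ^ m \<Longrightarrow>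
      cell (n + m) (k * l ^ m + j) = A * cell m j + B * cell m (l ^ m - 1 - j)" by blast
  from AB(3)[of 0 0] have "A + B = cell n k" by (simp add: cell_0)
  with AB that show ?thesis by blast
qed

section \<open>Membership and reindexing\<close>

text \<open>The assumption \<open>x < 1\<close> excludes the right endpoint that belongs to the last interval.\<close>
lemma mem_ladic_interval_iff:
  assumes k: "k < l ^ n" and x: "x < 1"
  shows "x \<in> ladic_interval l n k \<longleftrightarrow> \<lfloor>x * real l ^ n\<rfloor> = int k"
proof (cases "k = l ^ n - 1")
  case True
  then have "real k + 1 = real l ^ n" using k by (simp add: of_nat_diff)
  moreover have "x * real l ^ n < real l ^ n" using x lpow_pos[of n] by simp
  ultimately show ?thesis
    using True x lpow_pos[of n] by (auto simp: ladic_interval_def floor_eq_iff divide_simps)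
next
  case False
  then show ?thesis
    using lpow_pos[of n] l2 by (auto simp: ladic_interval_def floor_eq_iff divide_simps)
qed

lemma index_lt_1: "k < l ^ n \<Longrightarrow> real k / real l ^ n < 1"
  using lpow_pos[of n] by (simp add: divide_less_eq flip: of_nat_power)

lemma point_mem_ladic_interval_iff:
  assumes "k < l ^ n" "i < l ^ n" "j < l ^ m"
  shows "real (i * l ^ m + j) / real l ^ (n + m) \<in> ladic_interval l n k \<longleftrightarrow> i = k"
proof -
  have "real (i * l ^ m + j) / real l ^ (n + m) * real l ^ n = real (i * l ^ m + j) / real (l ^ m)"
    using l2 by (simp add: power_add)
  also have "\<lfloor>\<dots>\<rfloor> = int ((i * l ^ m + j) div l ^ m)"
    by (rule floor_divide_of_nat_eq)
  also have "(i * l ^ m + j) div l ^ m = i"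
    using assms(3) by (metis add.right_neutral div_less div_mult_self3 gr_implies_not0)
  finally show ?thesis
    using mem_ladic_interval_iff[OF assms(1) index_lt_1[OF index_less[OF assms(2,3)]]] by auto
qed

lemma inj_ladic_interval: "inj_on (ladic_interval l n) {..<l ^ n}"
proof (rule inj_onI)
  fix i k assume *: "i \<in> {..<l ^ n}" "k \<in> {..<l ^ n}" "ladic_interval l n i = ladic_interval l n k"
  then show "i = k"
    using point_mem_ladic_interval_iff[of i n i 0 0] point_mem_ladic_interval_iff[of k n i 0 0]
    by simp
qed

lemma sum_blocks:
  fixes f :: "nat \<Rightarrow> real"
  shows "sum f {..<n * b} = (\<Sum>i<n. \<Sum>j<b. f (i * b + j))"
proof -
  have "sum f {a..<a + b} = (\<Sum>j<b. f (a + j))" for a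
    by (induction b) (simp_all add: sum.op_ivl_Suc)
  then show ?thesis by (simp add: sum.nat_group[symmetric])
qed

lemma sum_flip:
  fixes f :: "nat \<Rightarrow> real"
  shows "(\<Sum>j<b. f (b - 1 - j)) = sum f {..<b}"
  using sum.nat_diff_reindex[of f b] by simp

section \<open>Moment sums and the spectrum\<close>

context
  fixes q :: real
  assumes q: "q < 0"
begin

text \<open>The moment sum of order \<open>q\<close> at generation \<open>n\<close>. Every term is a power of a positive number.\<close>
definition Z :: "nat \<Rightarrow> real" where
  "Z n = (\<Sum>k<l ^ n. cell n k powr q)"

lemma Z_ge_1: "Z n \<ge> 1"
proof -
  have "1 \<le> cell n 0 powr q"
    using powr_mono2'[of q "cell n 0" 1] q cell_pos[of 0 n] cell_le_1[of n 0] l2 by simp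
  also have "\<dots> \<le> Z n" unfolding Z_def using l2 by (intro member_le_sum) auto
  finally show ?thesis .
qed

lemma sum_descendants_le:
  assumes "k < l ^ n"
  shows "(\<Sum>j<l ^ m. cell (n + m) (k * l ^ m + j) powr q) \<le> 2 * cell n k powr q * Z m"
proof -
  obtain A B where AB: "A \<ge> 0" "B \<ge> 0" "A + B = cell n k"
    "\<And>m j. j < l ^ m \<Longrightarrow>
      cell (n + m) (k * l ^ m + j) = A * cell m j + B * cell m (l ^ m - 1 - j)"
    by (rule cell_decomp[OF assms]) blast
  (* The decomposition bounds the mass below by cell n k times the smaller of two masses;
     a negative power turns this into an upper bound, and the maximum is at most the sum. *)
  have le: "cell (n + m) (k * l ^ m + j) powr q
      \<le> cell n k powr q * (cell m j powr q + cell m (l ^ m - 1 - j) powr q)"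
    if j: "j < l ^ m" for j
  proof -
    let ?c = "min (cell m j) (cell m (l ^ m - 1 - j))"
    have c: "?c > 0" using cell_pos[OF j] cell_pos[OF flip_less[OF j]] by simp
    have "cell n k * ?c = A * ?c + B * ?c" by (simp add: AB(3)[symmetric] distrib_right)
    also have "\<dots> \<le> cell (n + m) (k * l ^ m + j)"
      unfolding AB(4)[OF j] using AB(1,2) by (intro add_mono mult_left_mono) auto
    finally have "cell (n + m) (k * l ^ m + j) powr q \<le> (cell n k * ?c) powr q"
      using q c cell_pos[OF assms] by (intro powr_mono2') auto
    also have "\<dots> = cell n k powr q * ?c powr q"
      using c cell_pos[OF assms] by (simp add: powr_mult)
    also have "\<dots> \<le> cell n k powr q * (cell m j powr q + cell m (l ^ m - 1 - j) powr q)"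
      by (intro mult_left_mono) (auto simp: min_def)
    finally show ?thesis .
  qed
  have "(\<Sum>j<l ^ m. cell (n + m) (k * l ^ m + j) powr q)
     \<le> (\<Sum>j<l ^ m. cell n k powr q * (cell m j powr q + cell m (l ^ m - 1 - j) powr q))"
    by (intro sum_mono le) simp
  also have "\<dots> = cell n k powr q * (Z m + (\<Sum>j<l ^ m. cell m (l ^ m - 1 - j) powr q))"
    by (simp add: sum_distrib_left[symmetric] sum.distrib Z_def)
  also have "(\<Sum>j<l ^ m. cell m (l ^ m - 1 - j) powr q) = Z m"
    unfolding Z_def by (rule sum_flip)
  finally show ?thesis by simp
qed

lemma Z_submult: "Z (n + m) \<le> 2 * Z n * Z m"
proof -
  have "Z (n + m) = (\<Sum>k<l ^ n. \<Sum>j<l ^ m. cell (n + m) (k * l ^ m + j) powr q)"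
    unfolding Z_def power_add by (rule sum_blocks)
  also have "\<dots> \<le> (\<Sum>k<l ^ n. 2 * cell n k powr q * Z m)"
    by (intro sum_mono sum_descendants_le) simp
  also have "\<dots> = 2 * Z n * Z m"
    by (simp only: Z_def[of n] sum_distrib_left sum_distrib_right)
  finally show ?thesis .
qed

lemma Z_submult_iter: "Z (n * j + r) \<le> (2 * Z n) ^ j * Z r"
proof (induction j)
  case (Suc j)
  have "Z (n * Suc j + r) \<le> 2 * Z n * Z (n * j + r)"
    using Z_submult[of n "n * j + r"] by (simp add: add.assoc)
  also have "\<dots> \<le> 2 * Z n * ((2 * Z n) ^ j * Z r)"
    using Suc Z_ge_1[of n] by (intro mult_left_mono) auto
  finally show ?case by (simp add: mult.assoc)
qed simp

lemma tau_n_eq: "tau_n l \<mu> n q = ln (Z n) / (real n * ln (real l))"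
proof -
  have eq: "{I. I \<in> ladic l n \<and> prob I \<noteq> 0} = ladic_interval l n ` {..<l ^ n}"
    using cell_pos[of _ n] by (force simp: ladic_def cell_def)
  have "(\<Sum>I | I \<in> ladic l n \<and> prob I \<noteq> 0. prob I powr q) = Z n"
    unfolding eq by (subst sum.reindex[OF inj_ladic_interval]) (simp add: Z_def cell_def)
  then show ?thesis by (simp add: tau_n_def)
qed

text \<open>The value of the spectrum at \<open>q\<close>; the conversion to a real number is harmless, as the spectrum is
  shown to be finite in the proof of \<open>powr_T_le\<close>.\<close>
definition T :: real where "T = real_of_ereal (Lq_spectrum l \<mu> q)"

lemma ln_l_pos: "ln (real l) > 0" using l2 by simp

text \<open>
  A Fekete argument: dividing \<open>m\<close> by \<open>n\<close> with remainder \<open>r\<close> gives \<open>Z m \<le> (2 * Z n) ^ (m div n) * Z r\<close>, which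
  bounds the upper limit by \<open>ln (2 * Z n) / (n * ln l)\<close>. The factor \<open>2\<close> comes from \<open>Z_submult\<close>.
\<close>
lemma powr_T_le: "real l powr (real n * T) \<le> 2 * Z n"
proof (cases "n = 0")
  case True then show ?thesis using Z_ge_1[of 0] l2 by simp
next
  case False
  define c where "c = ln (2 * Z n) / (n * ln l)"
  define K where "K = (\<Sum>r<n. ln (Z r)) / ln l"
  have lnZ: "ln (Z r) \<ge> 0" for r using Z_ge_1[of r] by simp
  have Zp: "Z r > 0" for r using Z_ge_1[of r] by simp
  have ln2: "ln (2 * Z n) \<ge> 0" using Z_ge_1[of n] by simp
  have tau_ge: "tau_n l \<mu> m q \<ge> 0" for m
    unfolding tau_n_eq using lnZ[of m] ln_l_pos by simp
  have tau_le: "tau_n l \<mu> m q \<le> c + K / m" if m: "m > 0" for m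
  proof -
    let ?r = "m mod n" and ?j = "m div n"
    have "ln (Z m) \<le> ln ((2 * Z n) ^ ?j * Z ?r)"
      using Z_submult_iter[of n ?j ?r] Zp[of m] Zp[of n] Zp[of ?r] by (subst ln_le_cancel_iff) auto
    also have "\<dots> = ?j * ln (2 * Z n) + ln (Z ?r)"
      using Zp[of n] Zp[of ?r] by (simp add: ln_mult ln_realpow distrib_left)
    also have "real ?j \<le> real m / real n" by (rule of_nat_div_le_of_nat)
    also have "ln (Z ?r) \<le> (\<Sum>r<n. ln (Z r))"
      using False by (intro member_le_sum lnZ) auto
    finally have le: "ln (Z m) \<le> m / n * ln (2 * Z n) + (\<Sum>r<n. ln (Z r))"
      using ln2 by (simp add: mult_right_mono)
    have "tau_n l \<mu> m q \<le> (m / n * ln (2 * Z n) + (\<Sum>r<n. ln (Z r))) / (m * ln l)"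
      unfolding tau_n_eq using le ln_l_pos by (intro divide_right_mono) auto
    also have "\<dots> = c + K / m"
      using m False ln_l_pos by (simp add: c_def K_def field_simps)
    finally show ?thesis .
  qed
  have "(\<lambda>m. c + K / real m) \<longlonglongrightarrow> c + 0"
    by (intro tendsto_add tendsto_const lim_const_over_n)
  then have "(\<lambda>m. ereal (c + K / real m)) \<longlonglongrightarrow> ereal c" by simp
  then have "limsup (\<lambda>m. ereal (c + K / real m)) = ereal c"
    by (intro lim_imp_Limsup) auto
  moreover have "Lq_spectrum l \<mu> q \<le> limsup (\<lambda>m. ereal (c + K / real m))"
    unfolding Lq_spectrum_def using tau_le
    by (intro Limsup_mono eventually_mono[OF eventually_gt_at_top[of 0]]) auto
  moreover have "limsup (\<lambda>m. ereal 0) \<le> Lq_spectrum l \<mu> q"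
    unfolding Lq_spectrum_def using tau_ge by (intro Limsup_mono always_eventually) auto
  ultimately have "0 \<le> Lq_spectrum l \<mu> q" "Lq_spectrum l \<mu> q \<le> ereal c"
    by (auto simp: Limsup_const zero_ereal_def)
  then have "T \<le> c" unfolding T_def by (cases "Lq_spectrum l \<mu> q") auto
  then have "T * (n * ln l) \<le> ln (2 * Z n)"
    unfolding c_def using False ln_l_pos by (subst (asm) pos_le_divide_eq) auto
  then have "exp (n * T * ln l) \<le> exp (ln (2 * Z n))" by (simp add: algebra_simps)
  then show ?thesis using Zp[of n] l2 by (simp add: powr_def)
qed

section \<open>Approximating measures\<close>

text \<open>The mass of generation \<open>m\<close> in the Patterson--Sullivan sum, at the critical exponent itself. The
  sum diverges there, so partial sums can be normalized without perturbing the exponent.\<close>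
definition term_mass :: "nat \<Rightarrow> real" where
  "term_mass m = real l powr (- (real m * T)) * Z m"

definition total_mass :: "nat \<Rightarrow> real" where
  "total_mass N = (\<Sum>m\<le>N. term_mass m)"

lemma term_mass_ge: "term_mass m \<ge> 1 / 2"
proof -
  have "1 = real l powr (- (real m * T)) * real l powr (real m * T)"
    using l2 by (simp add: powr_add[symmetric])
  also have "\<dots> \<le> real l powr (- (real m * T)) * (2 * Z m)"
    by (intro mult_left_mono powr_T_le) auto
  finally show ?thesis by (simp add: term_mass_def)
qed

lemma total_mass_ge: "total_mass N \<ge> (real N + 1) / 2"
proof -
  have "(\<Sum>m\<le>N. 1 / 2) \<le> total_mass N"
    unfolding total_mass_def by (intro sum_mono term_mass_ge)
  then show ?thesis by simp
qed

lemma total_mass_pos: "total_mass N > 0"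
  using total_mass_ge[of N] by (smt (verit) divide_pos_pos of_nat_0_le_iff)

lemma total_mass_ratio: "(\<lambda>N. c / total_mass N) \<longlonglongrightarrow> 0"
proof -
  have "filterlim (\<lambda>N. (real N + 1) / 2) at_top sequentially"
    by real_asymp
  then have "filterlim total_mass at_top sequentially"
    by (rule filterlim_at_top_mono) (rule always_eventually, simp only: total_mass_ge simp_thms)
  then show ?thesis by (rule real_tendsto_divide_at_top[OF tendsto_const])
qed

text \<open>
  The normalized partial sum: an atom sits at the left endpoint of each \<open>l\<close>-adic interval of generation at
  most \<open>N\<close>. These points avoid \<open>1\<close>, and each of them belongs to the interval it represents.
  The atoms are first collected on the disjoint union of the generations, since \<open>l\<close>-adic points
  recur in all later generations.
\<close>
definition approx :: "nat \<Rightarrow> real measure" where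
  "approx N = distr
     (point_measure (SIGMA m:{..N}. {..<l ^ m})
       (\<lambda>(m, k). real l powr (- (real m * T)) * cell m k powr q / total_mass N))
     borel (\<lambda>(m, k). real k / real l ^ m)"

lemma measure_approx:
  assumes "A \<in> sets borel"
  shows "measure (approx N) A = (\<Sum>m\<le>N. real l powr (- (real m * T)) *
      (\<Sum>k<l ^ m. cell m k powr q * indicator A (real k / real l ^ m))) / total_mass N"
proof -
  let ?X = "SIGMA m:{..N}. {..<l ^ m}"
  let ?f = "\<lambda>(m, k). real l powr (- (real m * T)) * cell m k powr q / total_mass N"
  let ?g = "\<lambda>(m, k). real k / real l ^ m"
  have f: "?f x \<ge> 0" for x using total_mass_pos[of N] by (auto split: prod.split)
  have "measure (approx N) A = measure (point_measure ?X ?f) (?g -` A \<inter> ?X)"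
    unfolding approx_def using assms by (subst measure_distr) (auto simp: space_point_measure)
  also have "\<dots> = (\<Sum>x\<in>?g -` A \<inter> ?X. ?f x)"
    using f by (subst measure_point_measure_finite_if) auto
  also have "\<dots> = (\<Sum>x\<in>?X. ?f x * indicator A (?g x))"
    by (intro sum.mono_neutral_cong_left) (auto simp: indicator_def)
  also have "\<dots> = (\<Sum>m\<le>N. \<Sum>k<l ^ m. ?f (m, k) * indicator A (?g (m, k)))"
    by (subst sum.Sigma) (auto simp: split_def)
  finally show ?thesis
    by (simp add: sum_distrib_left sum_divide_distrib mult_ac del: sum_mult_indicator sum_indicator_mult)
qed

lemma measure_approx_mono:
  assumes "A \<in> sets borel" "B \<in> sets borel" "A \<inter> {0..<1} \<subseteq> B"
  shows "measure (approx N) A \<le> measure (approx N) B"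
proof -
  have "indicator A (real k / real l ^ m) \<le> (indicator B (real k / real l ^ m) :: real)"
    if "k < l ^ m" for k m
    using index_lt_1[OF that] assms(3) by (auto simp: indicator_def)
  then show ?thesis
    unfolding measure_approx[OF assms(1)] measure_approx[OF assms(2)]
    using total_mass_pos[of N]
    by (intro divide_right_mono sum_mono mult_left_mono) auto
qed

lemma measure_approx_eq_1:
  assumes "A \<in> sets borel" "{0..<1} \<subseteq> A"
  shows "measure (approx N) A = 1"
proof -
  have "indicator A (real k / real l ^ m) = (1 :: real)" if "k < l ^ m" for k m
    using index_lt_1[OF that] assms(2) by (auto simp: indicator_def)
  then have "measure (approx N) A = total_mass N / total_mass N"
    unfolding measure_approx[OF assms(1)] by (simp add: total_mass_def term_mass_def Z_def)
  then show ?thesis using total_mass_pos[of N] by simp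
qed

lemma real_distribution_approx: "real_distribution (approx N)"
proof -
  have "measure (approx N) (space (approx N)) = 1"
    using measure_approx_eq_1[of UNIV N] by (simp add: approx_def)
  then have "emeasure (approx N) (space (approx N)) = 1"
    by (metis emeasure_eq_ennreal_measure ennreal_1 infinity_ennreal_def measure_def
        enn2real_top zero_neq_one)
  then have "prob_space (approx N)" by (rule prob_spaceI)
  then show ?thesis
    by (simp add: real_distribution_def real_distribution_axioms_def approx_def)
qed

text \<open>The bound that the limit measure satisfies, with the explicit constant \<open>2\<close>.\<close>
definition frostman_bound :: "nat \<Rightarrow> nat \<Rightarrow> real" where
  "frostman_bound n k = 2 * cell n k powr q * real l powr (- (real n * T))"

text \<open>
  Generations before \<open>n\<close> contribute at most \<open>total_mass n\<close>; generation \<open>n + m\<close> contributes the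
  descendants of the interval, at most \<open>frostman_bound n k\<close> times the mass of generation \<open>m\<close>.
\<close>
lemma measure_approx_ladic_le:
  assumes k: "k < l ^ n"
  shows "measure (approx N) (ladic_interval l n k) \<le> total_mass n / total_mass N + frostman_bound n k"
proof -
  let ?I = "ladic_interval l n k"
  let ?t = "\<lambda>m. real l powr (- (real m * T)) *
      (\<Sum>k<l ^ m. cell m k powr q * indicator ?I (real k / real l ^ m))"
  have I: "?I \<in> sets borel" by (simp add: ladic_interval_def)
  have tm: "term_mass m \<ge> 0" for m using term_mass_ge[of m] by simp
  have early: "?t m \<le> term_mass m" for m
    unfolding term_mass_def Z_def
    by (intro mult_left_mono sum_mono) (auto simp: indicator_def)
  have late: "?t (n + m) \<le> frostman_bound n k * term_mass m" for m
  proof -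
    have "(\<Sum>i<l ^ (n + m). cell (n + m) i powr q * indicator ?I (real i / real l ^ (n + m)))
      = (\<Sum>i<l ^ n. \<Sum>j<l ^ m. cell (n + m) (i * l ^ m + j) powr q *
          indicator ?I (real (i * l ^ m + j) / real l ^ (n + m)))"
      unfolding power_add[of l] by (rule sum_blocks)
    also have "\<dots> = (\<Sum>i<l ^ n. if i = k then \<Sum>j<l ^ m. cell (n + m) (k * l ^ m + j) powr q else 0)"
      using point_mem_ladic_interval_iff[OF k]
      by (intro sum.cong refl) (auto simp: indicator_def)
    also have "\<dots> = (\<Sum>j<l ^ m. cell (n + m) (k * l ^ m + j) powr q)" using k by simp
    also have "\<dots> \<le> 2 * cell n k powr q * Z m" by (rule sum_descendants_le[OF k])
    finally have "?t (n + m) \<le> real l powr (- (real (n + m) * T)) * (2 * cell n k powr q * Z m)"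
      by (intro mult_left_mono) auto
    moreover have "real l powr (- (real (n + m) * T))
        = real l powr (- (real n * T)) * real l powr (- (real m * T))"
      by (simp add: powr_add[symmetric] algebra_simps)
    then have "real l powr (- (real (n + m) * T)) * (2 * cell n k powr q * Z m)
        = frostman_bound n k * term_mass m"
      by (simp only: frostman_bound_def term_mass_def mult_ac)
    ultimately show ?thesis by linarith
  qed
  have fb: "frostman_bound n k \<ge> 0" by (simp add: frostman_bound_def)
  have "(\<Sum>m\<le>N. ?t m) = (\<Sum>m\<in>{..N} \<inter> {..<n}. ?t m) + (\<Sum>m\<in>{..N} - {..<n}. ?t m)"
    by (rule sum.Int_Diff) simp
  also have "(\<Sum>m\<in>{..N} \<inter> {..<n}. ?t m) \<le> (\<Sum>m\<in>{..N} \<inter> {..<n}. term_mass m)"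
    by (intro sum_mono early)
  also have "\<dots> \<le> total_mass n"
    unfolding total_mass_def using tm by (intro sum_mono2) auto
  also have "(\<Sum>m\<in>{..N} - {..<n}. ?t m) \<le> (\<Sum>m\<le>N. frostman_bound n k * term_mass m)"
  proof (rule sum_le_included[where i = "\<lambda>m. n + m"])
    show "\<forall>x\<in>{..N} - {..<n}. \<exists>y\<in>{..N}. n + y = x \<and> ?t x \<le> frostman_bound n k * term_mass y"
    proof
      fix x assume "x \<in> {..N} - {..<n}"
      then have *: "x - n \<in> {..N}" "n + (x - n) = x" by auto
      have "?t x \<le> frostman_bound n k * term_mass (x - n)"
        using late[of "x - n"] unfolding *(2) .
      with * show "\<exists>y\<in>{..N}. n + y = x \<and> ?t x \<le> frostman_bound n k * term_mass y"
        by (intro bexI[of _ "x - n"] conjI)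
    qed
  qed (use fb tm in auto)
  also have "\<dots> = frostman_bound n k * total_mass N"
    by (simp add: total_mass_def sum_distrib_left)
  finally have "(\<Sum>m\<le>N. ?t m) \<le> total_mass n + frostman_bound n k * total_mass N" by simp
  then show ?thesis
    unfolding measure_approx[OF I] using total_mass_pos[of N] by (simp add: field_simps)
qed

lemma eventually_measure_approx_le:
  assumes "k < l ^ n" "frostman_bound n k < e" "A \<in> sets borel" "A \<inter> {0..<1} \<subseteq> ladic_interval l n k"
  shows "eventually (\<lambda>N. measure (approx N) A \<le> e) sequentially"
proof -
  have "eventually (\<lambda>N. total_mass n / total_mass N < e - frostman_bound n k) sequentially"
    using order_tendstoD(2)[OF total_mass_ratio] assms(2) by simp
  then show ?thesis
  proof eventually_elim
    case (elim N)
    have "measure (approx N) A \<le> measure (approx N) (ladic_interval l n k)"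
      using assms(3,4) by (intro measure_approx_mono) (auto simp: ladic_interval_def)
    with measure_approx_ladic_le[OF assms(1), of N] elim show ?case by linarith
  qed
qed

section \<open>Dirac measures and the bound near \<open>l\<close>-adic points\<close>

lemma frostman_return:
  assumes x: "x \<in> {0..1}" and c: "c > 0"
    and le: "\<And>n k. k < l ^ n \<Longrightarrow> x \<in> ladic_interval l n k \<Longrightarrow> c \<le> frostman_bound n k"
  shows "frostman_measure l \<mu> q (return (restrict_space borel {0..1}) x)"
proof -
  let ?N = "return (restrict_space borel {0..1}) x"
  have "prob_space ?N" using x by (intro prob_space_return) simp
  moreover have "measure ?N I \<le> 2 / c * prob I powr q * real l powr (- (real n * T))"
    if I: "I \<in> ladic l n" for n I
  proof -
    obtain k where k: "k < l ^ n" "I = ladic_interval l n k"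
      using I by (auto simp: ladic_def)
    have "I \<subseteq> {0..1}" using ladic_interval_bounds(2,3)[OF k(1)] unfolding k(2) by blast
    then have "I \<in> sets (restrict_space borel {0..1})"
      by (simp add: sets_restrict_space_iff k(2) ladic_interval_def)
    then have "measure ?N I = indicator I x" by (simp add: measure_return)
    also have "\<dots> \<le> frostman_bound n k / c"
      using le[OF k(1)] c by (auto simp: indicator_def k(2) frostman_bound_def)
    finally show ?thesis by (simp add: frostman_bound_def k(2) cell_def)
  qed
  moreover have "2 / c > 0" using c by simp
  ultimately show ?thesis
    unfolding frostman_measure_def borel_prob_unit_def T_def by (auto intro!: exI[of _ "2 / c"])
qed

text \<open>
  With \<open>j m\<close> the first or the last index of generation \<open>m\<close>, this makes the bound arbitrarily small along the
  subintervals of a given \<open>l\<close>-adic interval that touch one of its endpoints. Both hypotheses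
  are needed because a reflection exchanges the endpoints.
\<close>
lemma frostman_bound_descendant:
  assumes k: "k < l ^ n" and e: "e > 0"
    and small: "\<And>e. e > 0 \<Longrightarrow> \<exists>m. frostman_bound m (j m) < e"
      "\<And>e. e > 0 \<Longrightarrow> \<exists>m. frostman_bound m (l ^ m - 1 - j m) < e"
    and j: "\<And>m. j m < l ^ m"
  shows "\<exists>m. frostman_bound (n + m) (k * l ^ m + j m) < e"
proof -
  obtain A B where AB: "A \<ge> 0" "B \<ge> 0" "A + B = cell n k"
    "\<And>m j. j < l ^ m \<Longrightarrow>
      cell (n + m) (k * l ^ m + j) = A * cell m j + B * cell m (l ^ m - 1 - j)"
    by (rule cell_decomp[OF k]) blast
  (* Depending on which coefficient is positive, the descendants are compared with the
     intervals j m themselves or with their mirror images; i stands for either choice. *)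
  have *: "\<exists>m. frostman_bound (n + m) (k * l ^ m + j m) < e"
    if D: "D > 0" and i: "\<And>m. i m < l ^ m" and sm: "\<And>e. e > 0 \<Longrightarrow> \<exists>m. frostman_bound m (i m) < e"
      and ge: "\<And>m. cell (n + m) (k * l ^ m + j m) \<ge> D * cell m (i m)" for D i
  proof -
    define c where "c = D powr q * real l powr (- (real n * T))"
    have c: "c > 0" using D l2 by (simp add: c_def)
    obtain m where m: "frostman_bound m (i m) < e / c" using sm[of "e / c"] e c by auto
    have "cell (n + m) (k * l ^ m + j m) powr q \<le> (D * cell m (i m)) powr q"
      using ge[of m] D cell_pos[OF i] q by (intro powr_mono2') auto
    also have "\<dots> = D powr q * cell m (i m) powr q"
      using D cell_pos[OF i, of m] by (simp add: powr_mult)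
    finally have "frostman_bound (n + m) (k * l ^ m + j m)
       \<le> 2 * (D powr q * cell m (i m) powr q) * real l powr (- (real (n + m) * T))"
      unfolding frostman_bound_def by (intro mult_right_mono mult_left_mono) auto
    also have "real l powr (- (real (n + m) * T))
        = real l powr (- (real n * T)) * real l powr (- (real m * T))"
      by (simp add: powr_add[symmetric] algebra_simps)
    also have "2 * (D powr q * cell m (i m) powr q) *
        (real l powr (- (real n * T)) * real l powr (- (real m * T))) = c * frostman_bound m (i m)"
      by (simp add: c_def frostman_bound_def)
    also have "\<dots> < e" using m c by (simp add: field_simps)
    finally show ?thesis by blast
  qed
  have "A > 0 \<or> B > 0" using AB(1-3) cell_pos[OF k] by linarith
  then show ?thesis
  proof
    assume "A > 0"
    then show ?thesis
      using AB(2) cell_nonneg by (intro *[of A j] small j) (auto simp: AB(4)[OF j])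
  next
    assume "B > 0"
    then show ?thesis
      using AB(1) cell_nonneg j
      by (intro *[of B "\<lambda>m. l ^ m - 1 - j m"] small flip_less) (auto simp: AB(4)[OF j])
  qed
qed

section \<open>The weak limit\<close>

text \<open>
  Shrinking the open interval to one whose endpoints are not atoms of the limit produces a continuity set.
\<close>
lemma measure_singleton_le_limit:
  assumes r: "strict_mono r" and M: "real_distribution M" and conv: "weak_conv_m (approx \<circ> r) M"
    and x: "a < x" "x < b" and ev: "eventually (\<lambda>N. measure (approx N) {a<..<b} \<le> c) sequentially"
  shows "measure M {x} \<le> c"
proof -
  interpret M: real_distribution M by (rule M)
  have ex: "\<exists>y\<in>{u<..<v}. measure M {y} = 0" if "u < v" for u v
  proof (rule ccontr)
    assume "\<not> ?thesis"
    then have "{u<..<v} \<subseteq> {y. measure M {y} > 0}" by (auto simp: less_le)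
    then have "countable {u<..<v}" using M.countable_atoms countable_subset by blast
    with uncountable_open_interval that show False by blast
  qed
  obtain y where y: "a < y" "y < x" "measure M {y} = 0" using ex[OF x(1)] by auto
  obtain z where z: "x < z" "z < b" "measure M {z} = 0" using ex[OF x(2)] by auto
  have "frontier {y<..<z} = {y, z}" using y z by (auto simp: frontier_def)
  moreover have "measure M {y, z} \<le> measure M {y} + measure M {z}"
    using measure_Un_le[of "{y}" M "{z}"] by (simp add: insert_commute)
  then have "measure M {y, z} = 0" using y z measure_nonneg[of M "{y, z}"] by linarith
  ultimately have "emeasure M (frontier {y<..<z}) = 0" by (simp add: M.emeasure_eq_measure)
  then have "(\<lambda>n. measure ((approx \<circ> r) n) {y<..<z}) \<longlonglongrightarrow> measure M {y<..<z}"
    using real_distribution_approx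
    by (intro weak_conv_imp_continuity_set_conv[OF _ M conv]) auto
  moreover have "eventually (\<lambda>n. measure ((approx \<circ> r) n) {y<..<z} \<le> c) sequentially"
    using eventually_subseq[OF r ev]
  proof eventually_elim
    case (elim n)
    have "measure (approx (r n)) {y<..<z} \<le> measure (approx (r n)) {a<..<b}"
      using y z by (intro measure_approx_mono) auto
    with elim show ?case by simp
  qed
  ultimately have "measure M {y<..<z} \<le> c" by (intro tendsto_upperbound) auto
  moreover have "measure M {x} \<le> measure M {y<..<z}"
    using y z by (intro M.finite_measure_mono) auto
  ultimately show ?thesis by linarith
qed

lemma exists_frostman: "\<exists>\<nu>. frostman_measure l \<mu> q \<nu>"
proof (cases "(\<exists>c>0. \<forall>n. c \<le> frostman_bound n 0) \<or> (\<exists>c>0. \<forall>n. c \<le> frostman_bound n (l ^ n - 1))")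
  case True
  then show ?thesis
  proof
    assume "\<exists>c>0. \<forall>n. c \<le> frostman_bound n 0"
    then obtain c where c: "c > 0" "\<And>n. c \<le> frostman_bound n 0" by blast
    have "k = 0" if "k < l ^ n" "0 \<in> ladic_interval l n k" for n k
      using that mem_ladic_interval_iff[OF that(1), of 0] by simp
    then have "frostman_measure l \<mu> q (return (restrict_space borel {0..1}) 0)"
      using c by (intro frostman_return[of _ c]) auto
    then show ?thesis by blast
  next
    assume "\<exists>c>0. \<forall>n. c \<le> frostman_bound n (l ^ n - 1)"
    then obtain c where c: "c > 0" "\<And>n. c \<le> frostman_bound n (l ^ n - 1)" by blast
    have "k = l ^ n - 1" if k: "k < l ^ n" and 1: "1 \<in> ladic_interval l n k" for n k
    proof (rule ccontr)
      assume "k \<noteq> l ^ n - 1"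
      with 1 have "real k + 1 > real (l ^ n)" using lpow_pos[of n]
        by (simp add: ladic_interval_def)
      with k show False by linarith
    qed
    then have "frostman_measure l \<mu> q (return (restrict_space borel {0..1}) 1)"
      using c by (intro frostman_return[of _ c]) auto
    then show ?thesis by blast
  qed
next
  case False
  have small0: "\<exists>m. frostman_bound m 0 < e" if "e > 0" for e
    using False that by (meson not_le)
  have small1: "\<exists>m. frostman_bound m (l ^ m - 1) < e" if "e > 0" for e
    using False that by (meson not_le)
  have lp: "0 < l ^ m" "l ^ m - 1 < l ^ m" for m using l2 by auto
  (* Each l-adic point has one-sided neighbourhoods to which the approximating
     measures eventually give small mass. They lie in an
     l-adic interval that starts or ends there; beyond 0 and 1 there is no mass at all. *)
  have right: "\<exists>b>real k / real l ^ n.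
      eventually (\<lambda>N. measure (approx N) {real k / real l ^ n..<b} \<le> e) sequentially"
    if k: "k \<le> l ^ n" and e: "e > 0" for k n e
  proof (cases "k = l ^ n")
    case True
    have "measure (approx N) {1..<2} \<le> measure (approx N) {}" for N
      by (intro measure_approx_mono) auto
    then have "eventually (\<lambda>N. measure (approx N) {1..<2} \<le> e) sequentially"
      using e by (intro always_eventually allI) (simp add: order.trans[of _ 0])
    moreover have "real k / real l ^ n = 1" using True l2 by simp
    ultimately show ?thesis by (simp only:) (rule exI[of _ 2], simp)
  next
    case False
    then have k: "k < l ^ n" using k by simp
    obtain m where m: "frostman_bound (n + m) (k * l ^ m + 0) < e"
      using frostman_bound_descendant[OF k e, of "\<lambda>m. 0"] small0 small1 lp(1) by auto
    have K: "k * l ^ m + 0 < l ^ (n + m)" by (rule index_less[OF k lp(1)])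
    let ?b = "(real (k * l ^ m + 0) + 1) / real (l ^ (n + m))"
    have x: "real k / real l ^ n = real (k * l ^ m + 0) / real (l ^ (n + m))"
      using l2 by (simp add: power_add)
    have "real k / real l ^ n < ?b"
      unfolding x using lpow_pos[of "n + m"] by (intro divide_strict_right_mono) auto
    moreover have "{real k / real l ^ n..<?b} \<inter> {0..<1} \<subseteq> ladic_interval l (n + m) (k * l ^ m + 0)"
      unfolding x ladic_interval_def by (cases "k * l ^ m + 0 = l ^ (n + m) - 1") auto
    then have "eventually (\<lambda>N. measure (approx N) {real k / real l ^ n..<?b} \<le> e) sequentially"
      by (intro eventually_measure_approx_le[OF K m]) auto
    ultimately show ?thesis by blast
  qed
  have left: "\<exists>a<real k / real l ^ n.
      eventually (\<lambda>N. measure (approx N) {a<..<real k / real l ^ n} \<le> e) sequentially"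
    if k: "k \<le> l ^ n" and e: "e > 0" for k n e
  proof (cases "k = 0")
    case True
    have "measure (approx N) {-1<..<0} \<le> measure (approx N) {}" for N
      by (intro measure_approx_mono) auto
    then have "eventually (\<lambda>N. measure (approx N) {-1<..<0} \<le> e) sequentially"
      using e by (intro always_eventually allI) (simp add: order.trans[of _ 0])
    then show ?thesis using True by (intro exI[of _ "-1"]) simp
  next
    case False
    then have k1: "k - 1 < l ^ n" using k by linarith
    obtain m where m: "frostman_bound (n + m) ((k - 1) * l ^ m + (l ^ m - 1)) < e"
      using frostman_bound_descendant[OF k1 e, of "\<lambda>m. l ^ m - 1"] small0 small1 lp(2) by auto
    let ?K = "(k - 1) * l ^ m + (l ^ m - 1)"
    have K: "?K < l ^ (n + m)" by (rule index_less[OF k1 lp(2)])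
    let ?a = "real ?K / real (l ^ (n + m))"
    have "?K + 1 = k * l ^ m" using False lp(1)[of m] by (cases k) auto
    then have "real ?K + 1 = real k * real l ^ m"
      by (metis of_nat_add of_nat_1 of_nat_mult of_nat_power)
    then have x: "real k / real l ^ n = (real ?K + 1) / real (l ^ (n + m))"
      using l2 by (simp add: power_add)
    have "?a < real k / real l ^ n"
      unfolding x using lpow_pos[of "n + m"] by (intro divide_strict_right_mono) auto
    moreover have "{?a<..<real k / real l ^ n} \<inter> {0..<1} \<subseteq> ladic_interval l (n + m) ?K"
      unfolding x using ladic_interval_bounds(1)[OF K] by blast
    then have "eventually (\<lambda>N. measure (approx N) {?a<..<real k / real l ^ n} \<le> e) sequentially"
      by (intro eventually_measure_approx_le[OF K m]) auto
    ultimately show ?thesis by blast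
  qed
  have "tight approx"
    unfolding tight_def
  proof (intro conjI allI impI)
    show "real_distribution (approx n)" for n by (rule real_distribution_approx)
    fix e :: real assume "e > 0"
    moreover have "measure (approx n) {-1<..1} = 1" for n
      by (rule measure_approx_eq_1) auto
    ultimately have "(-1 :: real) < 1 \<and> (\<forall>n. 1 - e < measure (approx n) {-1<..1})" by simp
    then show "\<exists>a b. a < b \<and> (\<forall>n. 1 - e < measure (approx n) {a<..b})" by blast
  qed
  from tight_imp_convergent_subsubsequence[OF this strict_mono_id]
  obtain r M where r: "strict_mono r" and M: "real_distribution M"
    and conv: "weak_conv_m (approx \<circ> r) M" by (auto simp: o_def)
  interpret M: real_distribution M by (rule M)
  have null: "measure M {real k / real l ^ n} = 0" if k: "k \<le> l ^ n" for k n
  proof -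
    let ?x = "real k / real l ^ n"
    have "measure M {?x} \<le> 2 * e" if e: "e > 0" for e
    proof -
      obtain a where a: "a < ?x" "eventually (\<lambda>N. measure (approx N) {a<..<?x} \<le> e) sequentially"
        using left[OF k e] by blast
      obtain b where b: "b > ?x" "eventually (\<lambda>N. measure (approx N) {?x..<b} \<le> e) sequentially"
        using right[OF k e] by blast
      have "eventually (\<lambda>N. measure (approx N) {a<..<b} \<le> 2 * e) sequentially"
        using a(2) b(2)
      proof eventually_elim
        case (elim N)
        interpret A: real_distribution "approx N" by (rule real_distribution_approx)
        have "{a<..<b} = {a<..<?x} \<union> {?x..<b}" using a(1) b(1) by auto
        then have "measure (approx N) {a<..<b} \<le> measure (approx N) {a<..<?x} + measure (approx N) {?x..<b}"
          using measure_Un_le[of "{a<..<?x}" "approx N" "{?x..<b}"] by simp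
        with elim show ?case by linarith
      qed
      with measure_singleton_le_limit[OF r M conv a(1) b(1)] show ?thesis by blast
    qed
    from this[of "measure M {?x} / 4"] show ?thesis
      using measure_nonneg[of M "{?x}"] by (cases "measure M {?x} = 0") auto
  qed
  have lim: "(\<lambda>n. measure (approx (r n)) A) \<longlonglongrightarrow> measure M A"
    if k: "k \<le> l ^ n" "j \<le> l ^ n" and A: "A \<in> sets borel"
      "frontier A \<subseteq> {real k / real l ^ n, real j / real l ^ n}" for A k j n
  proof -
    let ?x = "real k / real l ^ n" and ?y = "real j / real l ^ n"
    have "measure M (frontier A) \<le> measure M {?x, ?y}"
      using A(2) by (intro M.finite_measure_mono) auto
    also have "\<dots> \<le> measure M {?x} + measure M {?y}"
      using measure_Un_le[of "{?x}" M "{?y}"] by (simp add: insert_commute)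
    finally have "measure M (frontier A) = 0"
      using null[OF k(1)] null[OF k(2)] measure_nonneg[of M "frontier A"] by linarith
    then have "emeasure M (frontier A) = 0" by (simp add: M.emeasure_eq_measure)
    then show ?thesis
      using weak_conv_imp_continuity_set_conv[of "approx \<circ> r" M A] real_distribution_approx M conv A(1)
      by (simp add: o_def)
  qed
  have "(\<lambda>n. measure (approx (r n)) {0..1}) \<longlonglongrightarrow> measure M {0..1}"
    by (rule lim[of 0 0 1]) (auto simp: frontier_def)
  moreover have "measure (approx (r n)) {0..1} = 1" for n
    by (rule measure_approx_eq_1) auto
  ultimately have one: "measure M {0..1} = 1" by (simp add: LIMSEQ_const_iff)
  (* The limit lives on the real line; it is restricted to the unit interval, which has full mass. *)
  let ?N = "restrict_space M {0..1}"
  have "prob_space ?N"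
    using one by (intro prob_space_restrict_space) (auto simp: M.emeasure_eq_measure)
  moreover have "sets ?N = sets (restrict_space borel {0..1})"
    by (intro sets_restrict_space_cong) simp
  moreover have "measure ?N I \<le> 2 * prob I powr q * real l powr (- (real n * T))"
    if I: "I \<in> ladic l n" for n I
  proof -
    obtain k where k: "k < l ^ n" "I = ladic_interval l n k"
      using I by (auto simp: ladic_def)
    have I_borel: "I \<in> sets borel" by (simp add: k(2) ladic_interval_def)
    have "I \<subseteq> {0..1}" using ladic_interval_bounds(2,3)[OF k(1)] unfolding k(2) by blast
    then have "measure ?N I = measure M I" by (intro measure_restrict_space) auto
    also have "\<dots> \<le> frostman_bound n k"
    proof (rule LIMSEQ_le)
      have "frontier I \<subseteq> {real k / real (l ^ n)..(real k + 1) / real (l ^ n)}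
          - {real k / real (l ^ n)<..<(real k + 1) / real (l ^ n)}"
        unfolding frontier_def k(2) using ladic_interval_bounds(1,2)[OF k(1)]
        by (intro Diff_mono closure_minimal interior_maximal) auto
      also have "\<dots> \<subseteq> {real k / real l ^ n, real (Suc k) / real l ^ n}" by (auto simp: add.commute)
      finally show "(\<lambda>n. measure (approx (r n)) I) \<longlonglongrightarrow> measure M I"
        using k(1) I_borel by (intro lim[of k n "Suc k"]) auto
      have "(\<lambda>i. total_mass n / total_mass (r i)) \<longlonglongrightarrow> 0"
        using LIMSEQ_subseq_LIMSEQ[OF total_mass_ratio r] by (simp add: o_def)
      then have "(\<lambda>i. total_mass n / total_mass (r i) + frostman_bound n k) \<longlonglongrightarrow> 0 + frostman_bound n k"
        by (intro tendsto_add tendsto_const)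
      then show "(\<lambda>i. total_mass n / total_mass (r i) + frostman_bound n k) \<longlonglongrightarrow> frostman_bound n k"
        by simp
      show "\<exists>N. \<forall>i\<ge>N. measure (approx (r i)) I \<le> total_mass n / total_mass (r i) + frostman_bound n k"
        using measure_approx_ladic_le[OF k(1)] by (auto simp: k(2))
    qed
    finally show ?thesis by (simp add: frostman_bound_def k(2) cell_def)
  qed
  ultimately have "frostman_measure l \<mu> q ?N"
    unfolding frostman_measure_def borel_prob_unit_def T_def by (auto intro!: exI[of _ 2])
  then show ?thesis by blast
qed

end

end

theorem theorem3p4:
  fixes l :: nat and p :: "nat \<Rightarrow> real" and \<mu> :: "real measure"
  assumes "l \<ge> 2"
    and "\<And>i. i < 2 * l \<Longrightarrow> p i \<ge> 0"
    and "(\<Sum>i<2 * l. p i) = 1"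
    and "\<And>i. i < l \<Longrightarrow> p i + p (i + l) > 0"
    and "borel_prob_unit \<mu>"
    and "self_similar l p \<mu>"
  shows "\<forall>q<0. \<exists>\<nu>. frostman_measure l \<mu> q \<nu>"
proof -
  interpret flip_ladic l p \<mu> by standard (use assms in auto)
  show ?thesis using exists_frostman by blast
qed

end
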